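(* Let $R$ be an entrywise non-negative real symmetric matrix of order $n$ with largest eigenvalue $\rho$ and nullity $\eta(R)=\kappa$, and suppose that $\mathbf{x}$ is a nonzero entrywise non-negative vector such that $$\mu=\frac{\mathbf{x}^{T}R\,\mathbf{x}}{\mathbf{x}^{T}\mathbf{x}}\geq 1 .$$ Then $$\mathcal{E}(R)\ \geq\ \mu+n-\kappa-1+\ln\bigl|\Upsilon_{n-\kappa}(R)\bigr|-\ln\mu .$$ Equality holds if and only if $\mathbf{x}$ is an eigenvector of $R$ associated to $\rho$ and all the nonzero eigenvalues of $R$ have absolute value equal to $1$, except maybe for its largest eigenvalue.
   Context: For a Hermitian matrix $R$, the energy $\mathcal{E}(R)$ is the sum of the absolute values of its eigenvalues, counted with multiplicity. The nullity $\eta(R)$ is the multiplicity of $0$ as an eigenvalue of $R$. For a square matrix $M$ of order $n$ with eigenvalues $\mu_1,\dots,\mu_n$, $\Upsilon_k(M)=\sum_{1\le i_1<\cdots<i_k\le n}\mu_{i_1}\cdots\mu_{i_k}$. Eigenvalues are counted with multiplicity; "except maybe for its largest eigenvalue" means that one copy of $\rho$ is removed from the list of nonzero eigenvalues. *)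

theory Defs
  imports
    Complex_Main
    "HOL-Computational_Algebra.Fundamental_Theorem_Algebra"
    "HOL-Combinatorics.Permutations"
    "Jordan_Normal_Form.Char_Poly"
begin

definition eigvals :: "complex mat \<Rightarrow> complex multiset" where
  "eigvals M = proots (char_poly M)"

lemma size_eigvals: "M \<in> carrier_mat n n \<Longrightarrow> size (eigvals M) = n"
  by (simp add: eigvals_def size_proots_complex degree_monic_char_poly)

lemma set_eigvals: "M \<in> carrier_mat n n \<Longrightarrow> set_mset (eigvals M) = {a. eigenvalue M a}"
  using degree_monic_char_poly[of M n]
  by (subst eigvals_def, subst set_count_proots)
    (auto simp: eigenvalue_root_char_poly)

definition energy :: "complex mat \<Rightarrow> real" where
  "energy M = (\<Sum>a\<in>#eigvals M. cmod a)"

definition nullity :: "complex mat \<Rightarrow> nat" where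
  "nullity M = count (eigvals M) 0"

definition elem_sym :: "nat \<Rightarrow> complex list \<Rightarrow> complex" where
  "elem_sym k as = (\<Sum>I | I \<subseteq> {..<length as} \<and> card I = k. \<Prod>i\<in>I. as ! i)"

(* The chosen enumeration of the eigenvalues is irrelevant, see Upsilon_eq below. *)
definition Upsilon :: "nat \<Rightarrow> complex mat \<Rightarrow> complex" where
  "Upsilon k M = elem_sym k (SOME as. mset as = eigvals M)"

lemma elem_sym_mset_cong:
  assumes "mset as = mset bs"
  shows "elem_sym k as = elem_sym k bs"
proof -
  obtain p where p: "p permutes {..<length bs}" "permute_list p bs = as"
    using mset_eq_permutation[OF assms] by blast
  have len: "length as = length bs" using assms by (rule mset_eq_length)
  have inj: "inj p" using p(1) by (rule permutes_inj)
  have inv_perm: "(inv_into UNIV p) permutes {..<length bs}" using p(1) by (rule permutes_inv)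
  have nth: "as ! i = bs ! p i" if "i < length bs" for i
    using p that by (auto simp: permute_list_nth)
  show ?thesis
    unfolding elem_sym_def len
  proof (rule sum.reindex_bij_witness[where j = "image p" and i = "image (inv_into UNIV p)"])
    fix I assume I: "I \<in> {I. I \<subseteq> {..<length bs} \<and> card I = k}"
    show "(inv_into UNIV p) ` p ` I = I" using inj by (simp add: image_image)
    show "p ` I \<in> {I. I \<subseteq> {..<length bs} \<and> card I = k}"
      using I permutes_image[OF p(1)] inj by (auto simp: card_image inj_on_subset)
    have "(\<Prod>i\<in>p ` I. bs ! i) = (\<Prod>i\<in>I. bs ! p i)"
      using inj by (subst prod.reindex) (auto intro: inj_on_subset)
    also have "\<dots> = (\<Prod>i\<in>I. as ! i)"
      using I nth by (intro prod.cong) auto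
    finally show "(\<Prod>i\<in>p ` I. bs ! i) = (\<Prod>i\<in>I. as ! i)" .
  next
    fix I assume I: "I \<in> {I. I \<subseteq> {..<length bs} \<and> card I = k}"
    show "p ` inv_into UNIV p ` I = I"
      using permutes_surj[OF p(1)] by (simp add: image_image surj_f_inv_f)
    show "inv_into UNIV p ` I \<in> {I. I \<subseteq> {..<length bs} \<and> card I = k}"
      using I permutes_image[OF inv_perm] permutes_inj[OF inv_perm]
      by (auto simp: card_image inj_on_subset)
  qed
qed

lemma Upsilon_eq:
  assumes "mset as = eigvals M"
  shows "Upsilon k M = elem_sym k as"
  unfolding Upsilon_def
  by (rule elem_sym_mset_cong) (use assms someI[of "\<lambda>as. mset as = eigvals M" as] in simp)

end

theory Submission
  imports Defs "HOL-Analysis.Function_Topology"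
begin

text \<open>
  The term \<open>ln \<bar>\<Upsilon>\<bar>\<close> of the bound is the logarithm of the product of the absolute values of the nonzero
  eigenvalues, so the difference of the two sides splits into
  \<open>(\<rho> - ln \<rho>) - (\<mu> - ln \<mu>)\<close> and one summand \<open>\<bar>a\<bar> - 1 - ln \<bar>a\<bar> \<ge> 0\<close> for each remaining
  nonzero eigenvalue \<open>a\<close>, which vanishes only for \<open>\<bar>a\<bar> = 1\<close>. The function \<open>t - ln t\<close> increases
  strictly for \<open>t \<ge> 1\<close>, and \<open>1 \<le> \<mu> \<le> \<rho>\<close>, with \<open>\<mu> = \<rho>\<close> only at eigenvectors of \<open>\<rho>\<close>. For the latter,
  the Rayleigh quotient attains its maximum by compactness, and perturbing a maximizer \<open>x\<close> in the
  direction of the residual \<open>A x - c x\<close> shows that the residual vanishes.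
\<close>

section \<open>Rayleigh quotients of real symmetric matrices\<close>

text \<open>With \<open>w\<close> the residual, \<open>bound\<close> at \<open>x + t w\<close> loses
  its constant terms by \<open>eq\<close>. By symmetry the linear coefficient left over is
  \<open>2 * (w \<bullet> w)\<close>, which small \<open>t > 0\<close> forces to be at most
  0.\<close>

lemma rayleigh_maximizer_eigen:
  fixes A :: "real mat"
  assumes A: "A \<in> carrier_mat n n" and sym: "transpose_mat A = A"
    and x: "x \<in> carrier_vec n"
    and bound: "\<And>z. z \<in> carrier_vec n \<Longrightarrow> z \<bullet> (A *\<^sub>v z) \<le> c * (z \<bullet> z)"
    and eq: "x \<bullet> (A *\<^sub>v x) = c * (x \<bullet> x)"
  shows "A *\<^sub>v x = c \<cdot>\<^sub>v x"
proof -
  define w where "w = A *\<^sub>v x - c \<cdot>\<^sub>v x"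
  define d where "d = w \<bullet> (A *\<^sub>v w) - c * (w \<bullet> w)"
  have w: "w \<in> carrier_vec n" using A x by (simp add: w_def)
  note [simp] = A x w mult_mat_vec_carrier[OF A]
  have x_Aw: "x \<bullet> (A *\<^sub>v w) = w \<bullet> (A *\<^sub>v x)"
    using transpose_vec_mult_scalar[OF A w x] comm_scalar_prod[OF w, of "A *\<^sub>v x"]
    by (simp add: sym)
  have ww: "w \<bullet> (A *\<^sub>v x) - c * (w \<bullet> x) = w \<bullet> w"
    using scalar_prod_minus_distrib[OF w, of "A *\<^sub>v x" "c \<cdot>\<^sub>v x"]
    by (simp add: scalar_prod_smult_distrib[OF w x] flip: w_def)
  have pert: "2 * (w \<bullet> w) + t * d \<le> 0" if t: "t > 0" for t
  proof -
    have "(x + t \<cdot>\<^sub>v w) \<bullet> (A *\<^sub>v (x + t \<cdot>\<^sub>v w)) \<le> c * ((x + t \<cdot>\<^sub>v w) \<bullet> (x + t \<cdot>\<^sub>v w))"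
      by (rule bound) simp
    also have "(x + t \<cdot>\<^sub>v w) \<bullet> (A *\<^sub>v (x + t \<cdot>\<^sub>v w)) =
        c * (x \<bullet> x) + 2 * t * (w \<bullet> (A *\<^sub>v x)) + t\<^sup>2 * (w \<bullet> (A *\<^sub>v w))"
      by (simp add: mult_add_distrib_mat_vec[OF A] mult_mat_vec[OF A] x_Aw eq
          scalar_prod_add_distrib[of _ n] add_scalar_prod_distrib[of _ n]
          scalar_prod_smult_distrib[of _ n] smult_scalar_prod_distrib[of _ n] power2_eq_square algebra_simps)
    also have "(x + t \<cdot>\<^sub>v w) \<bullet> (x + t \<cdot>\<^sub>v w) = x \<bullet> x + 2 * t * (w \<bullet> x) + t\<^sup>2 * (w \<bullet> w)"
      by (simp add: comm_scalar_prod[OF x w]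
          scalar_prod_add_distrib[of _ n] add_scalar_prod_distrib[of _ n]
          scalar_prod_smult_distrib[of _ n] smult_scalar_prod_distrib[of _ n] power2_eq_square algebra_simps)
    finally have "t * (2 * (w \<bullet> (A *\<^sub>v x) - c * (w \<bullet> x)) + t * d) \<le> 0"
      by (simp add: d_def power2_eq_square algebra_simps)
    then show ?thesis using t by (simp add: ww mult_le_0_iff)
  qed
  have "w \<bullet> w \<le> 0"
  proof (rule ccontr)
    assume "\<not> w \<bullet> w \<le> 0"
    then have pos: "w \<bullet> w > 0" by simp
    \<comment> \<open>The value \<open>t = w \<bullet> w / (1 + \<bar>d\<bar>)\<close> is small
      enough that \<open>t * d\<close> cancels at most one of the two copies of
      \<open>w \<bullet> w\<close> in \<open>pert\<close>.\<close>
    have "w \<bullet> w * -1 \<le> w \<bullet> w * (d / (1 + \<bar>d\<bar>))"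
      using pos by (intro mult_left_mono) (auto simp: pos_le_divide_eq)
    then show False
      using pert[of "w \<bullet> w / (1 + \<bar>d\<bar>)"] pos by simp
  qed
  then have "w = 0\<^sub>v n"
    using conjugate_square_ge_0_vec[of w] conjugate_square_eq_0_vec[OF w] by simp
  then have w0: "A *\<^sub>v x - c \<cdot>\<^sub>v x = 0\<^sub>v n"
    by (simp add: w_def)
  show ?thesis
  proof (rule eq_vecI)
    fix i assume "i < dim_vec (c \<cdot>\<^sub>v x)"
    then show "(A *\<^sub>v x) $ i = (c \<cdot>\<^sub>v x) $ i"
      using arg_cong[OF w0, of "\<lambda>v. v $ i"]
      by (simp add: carrier_matD[OF A] carrier_vecD[OF x])
  qed (simp add: carrier_matD[OF A] carrier_vecD[OF x])
qed

text \<open>JNF vectors carry no topology, so compactness is taken from the product topology on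
  sequences.\<close>

lemma compact_coordinate_sphere:
  "compact {f :: nat \<Rightarrow> real. (\<forall>i\<ge>n. f i = 0) \<and> (\<Sum>i<n. (f i)\<^sup>2) = 1}" (is "compact ?S")
proof -
  let ?B = "Pi\<^sub>E UNIV (\<lambda>i::nat. {-1..1::real})"
  \<comment> \<open>Tychonoff's theorem makes the cube compact; the sphere is a closed subset of
    it.\<close>
  have "compactin (product_topology (\<lambda>i::nat. euclidean) UNIV) ?B"
    by (subst compactin_PiE) auto
  then have compact: "compact ?B"
    by (simp add: euclidean_product_topology)
  have "?S = (\<Inter>i\<in>{n..}. {f. f i = 0}) \<inter> {f. (\<Sum>i<n. (f i)\<^sup>2) = 1}"
    by auto
  also have "closed \<dots>"
    by (intro closed_Int closed_INT ballI closed_Collect_eq continuous_intros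
        continuous_on_product_coordinates)
  finally have closed: "closed ?S" .
  have "f i \<in> {-1..1}" if f: "f \<in> ?S" for f i
  proof (cases "i < n")
    case True
    then have "(f i)\<^sup>2 \<le> (\<Sum>i<n. (f i)\<^sup>2)"
      by (intro member_le_sum) auto
    then show ?thesis
      using f by (auto simp: abs_square_le_1 abs_le_iff)
  \<comment> \<open>Fixing the coordinates from \<open>n\<close> on to 0 keeps these inside the cube
    too.\<close>
  qed (use f in auto)
  then have "?S \<subseteq> ?B" by auto
  then have "?S = ?B \<inter> ?S" by blast
  then show ?thesis
    using compact_Int_closed[OF compact closed] by simp
qed

text \<open>The maximum of the quadratic form on the unit sphere serves as \<open>l\<close>:
  homogeneity extends the bound to all vectors, and the maximizer is then an eigenvector. No
  diagonalization is involved.\<close>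

lemma symmetric_rayleigh_attained:
  fixes A :: "real mat"
  assumes A: "A \<in> carrier_mat n n" and sym: "transpose_mat A = A" and n: "n > 0"
  obtains l where "eigenvalue A l" "\<And>z. z \<in> carrier_vec n \<Longrightarrow> z \<bullet> (A *\<^sub>v z) \<le> l * (z \<bullet> z)"
proof -
  let ?S = "{f :: nat \<Rightarrow> real. (\<forall>i\<ge>n. f i = 0) \<and> (\<Sum>i<n. (f i)\<^sup>2) = 1}"
  let ?q = "\<lambda>f. vec n f \<bullet> (A *\<^sub>v vec n f)"
  have sq: "vec n f \<bullet> vec n f = (\<Sum>i<n. (f i)\<^sup>2)" for f :: "nat \<Rightarrow> real"
    by (simp add: scalar_prod_def power2_eq_square lessThan_atLeast0)
  have q: "?q f = (\<Sum>i<n. f i * (\<Sum>j<n. A $$ (i, j) * f j))" for f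
    using A by (simp add: scalar_prod_def lessThan_atLeast0)
  have cont: "continuous_on ?S ?q"
    unfolding q
    by (intro continuous_intros continuous_on_subset[OF continuous_on_product_coordinates subset_UNIV])
  \<comment> \<open>The first unit vector shows that the sphere is nonempty, as
    \<open>n > 0\<close>.\<close>
  have "(\<Sum>i<n. (of_bool (i = 0) :: real)\<^sup>2) = (\<Sum>i<n. if i = 0 then 1 else 0)"
    by (intro sum.cong) auto
  then have "(\<lambda>i. of_bool (i = 0)) \<in> ?S"
    using n by simp
  then have "?S \<noteq> {}" by (metis empty_iff)
  from continuous_attains_sup[OF compact_coordinate_sphere this cont]
  obtain g where g: "g \<in> ?S" and max: "\<And>f. f \<in> ?S \<Longrightarrow> ?q f \<le> ?q g"
    by blast
  have bound: "z \<bullet> (A *\<^sub>v z) \<le> ?q g * (z \<bullet> z)" if z: "z \<in> carrier_vec n" for z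
  proof (cases "z = 0\<^sub>v n")
    case True
    then show ?thesis using A by simp
  next
    case False
    define s where "s = z \<bullet> z"
    have s: "s > 0"
      using conjugate_square_greater_0_vec[OF z] False by (simp add: s_def)
    define f where "f i = (if i < n then z $ i / sqrt s else 0)" for i
    have vf: "vec n f = (1 / sqrt s) \<cdot>\<^sub>v z"
      using z by (intro eq_vecI) (auto simp: f_def)
    have "vec n f \<bullet> vec n f = 1"
      using z s by (simp add: vf s_def[symmetric])
    then have "f \<in> ?S" by (simp add: sq) (simp add: f_def)
    from max[OF this] show ?thesis
      using z s A by (simp add: vf mult_mat_vec[OF A] s_def[symmetric] field_simps)
  qed
  have gg: "vec n g \<bullet> vec n g = 1" using g by (simp add: sq)
  have "A *\<^sub>v vec n g = ?q g \<cdot>\<^sub>v vec n g"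
    by (rule rayleigh_maximizer_eigen[OF A sym _ bound]) (simp_all add: gg)
  moreover have "vec n g \<noteq> 0\<^sub>v n" using gg by auto
  ultimately have "eigenvalue A (?q g)"
    unfolding eigenvalue_def eigenvector_def using A by (intro exI[of _ "vec n g"]) auto
  then show ?thesis using bound that by blast
qed

lemma symmetric_rayleigh_le:
  fixes A :: "real mat"
  assumes A: "A \<in> carrier_mat n n" and sym: "transpose_mat A = A"
    and top: "\<forall>a. eigenvalue A a \<longrightarrow> a \<le> \<rho>" and z: "z \<in> carrier_vec n"
  shows "z \<bullet> (A *\<^sub>v z) \<le> \<rho> * (z \<bullet> z)"
\<comment> \<open>For \<open>n = 0\<close> there is no eigenvalue to compare with, but both sides
  are empty sums.\<close>
proof (cases "n = 0")
  case True
  then show ?thesis using A z by (simp add: scalar_prod_def)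
next
  case False
  obtain l where "eigenvalue A l" and l: "z \<bullet> (A *\<^sub>v z) \<le> l * (z \<bullet> z)"
    using symmetric_rayleigh_attained[OF A sym] False z by blast
  then have "l * (z \<bullet> z) \<le> \<rho> * (z \<bullet> z)"
    using top conjugate_square_ge_0_vec[of z] by (intro mult_right_mono) auto
  with l show ?thesis by linarith
qed

lemma symmetric_rayleigh_eq_iff:
  fixes A :: "real mat"
  assumes A: "A \<in> carrier_mat n n" and sym: "transpose_mat A = A"
    and top: "\<forall>a. eigenvalue A a \<longrightarrow> a \<le> \<rho>"
    and z: "z \<in> carrier_vec n" "z \<noteq> 0\<^sub>v n"
  shows "z \<bullet> (A *\<^sub>v z) = \<rho> * (z \<bullet> z) \<longleftrightarrow> eigenvector A z \<rho>"
proof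
  assume "z \<bullet> (A *\<^sub>v z) = \<rho> * (z \<bullet> z)"
  from rayleigh_maximizer_eigen[OF A sym z(1) symmetric_rayleigh_le[OF A sym top] this]
  show "eigenvector A z \<rho>" using A z by (simp add: eigenvector_def)
next
  assume "eigenvector A z \<rho>"
  then show "z \<bullet> (A *\<^sub>v z) = \<rho> * (z \<bullet> z)" using z by (simp add: eigenvector_def)
qed

section \<open>The elementary symmetric function as a product of nonzero eigenvalues\<close>

text \<open>Any index set of this size other than the initial segment hits an appended zero, so a
  single product survives.\<close>

lemma elem_sym_append_zeros:
  "elem_sym (length bs) (bs @ replicate k 0) = prod_list bs"
proof -
  let ?as = "bs @ replicate k 0"
  let ?F = "{I. I \<subseteq> {..<length ?as} \<and> card I = length bs}"
  have zero: "(\<Prod>i\<in>I. ?as ! i) = 0" if I: "I \<in> ?F - {{..<length bs}}" for I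
  proof -
    have "finite I" using I finite_subset[of I "{..<length ?as}"] by auto
    moreover have "\<not> I \<subseteq> {..<length bs}"
      using I card_subset_eq[of "{..<length bs}" I] by auto
    then obtain i where "i \<in> I" "length bs \<le> i"
      by (meson lessThan_iff not_le subsetI)
    moreover have "i < length bs + k" using I \<open>i \<in> I\<close> by auto
    ultimately show ?thesis by (intro prod_zero bexI[of _ i]) (auto simp: nth_append)
  qed
  have "elem_sym (length bs) ?as = (\<Sum>I\<in>{{..<length bs}}. \<Prod>i\<in>I. ?as ! i)"
    unfolding elem_sym_def using zero by (intro sum.mono_neutral_right) auto
  also have "\<dots> = (\<Prod>i<length bs. bs ! i)"
    by (simp add: nth_append)
  finally show ?thesis
    by (simp add: prod.list_conv_set_nth lessThan_atLeast0)
qed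

text \<open>By \<open>Upsilon_eq\<close> the eigenvalues may be listed with the nonzero ones
  first.\<close>

lemma Upsilon_nonzero_eigvals:
  assumes M: "M \<in> carrier_mat n n"
  shows "Upsilon (n - nullity M) M = prod_mset (filter_mset (\<lambda>a. a \<noteq> 0) (eigvals M))"
proof -
  obtain bs where bs: "mset bs = filter_mset (\<lambda>a. a \<noteq> 0) (eigvals M)"
    using ex_mset by blast
  have split: "eigvals M = mset bs + replicate_mset (nullity M) 0"
    using multiset_partition[of "eigvals M" "\<lambda>a. a \<noteq> 0"]
    by (simp add: bs nullity_def filter_eq_replicate_mset)
  have "length bs = n - nullity M"
    using arg_cong[OF split, of size] size_eigvals[OF M] by simp
  then show ?thesis
    using Upsilon_eq[of "bs @ replicate (nullity M) 0" M "length bs"]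
      elem_sym_append_zeros[of bs "nullity M"] split
    by (metis bs mset_append mset_replicate prod_mset_prod_list)
qed

section \<open>Logarithmic inequalities\<close>

text \<open>This sums \<open>ln t \<le> t - 1\<close>, which is strict unless \<open>t = 1\<close>,
  over the absolute values in \<open>N\<close>.\<close>

lemma sum_ln_cmod_gap:
  assumes "0 \<notin># N"
  shows "ln (cmod (prod_mset N)) + real (size N) \<le> (\<Sum>a\<in>#N. cmod a)"
    and "(\<Sum>a\<in>#N. cmod a) = ln (cmod (prod_mset N)) + real (size N) \<longleftrightarrow> (\<forall>a\<in>#N. cmod a = 1)"
proof -
  \<comment> \<open>Both claims go through one induction: the equality case needs the inequality for
    \<open>N\<close>, since a sum of two nonnegative gaps vanishes only if both do.\<close>
  have "ln (cmod (prod_mset N)) + real (size N) \<le> (\<Sum>a\<in>#N. cmod a) \<and>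
    ((\<Sum>a\<in>#N. cmod a) = ln (cmod (prod_mset N)) + real (size N) \<longleftrightarrow> (\<forall>a\<in>#N. cmod a = 1))"
    using assms
  proof (induction N)
    case (add a N)
    have a: "cmod a > 0" and N: "cmod (prod_mset N) > 0"
      using add.prems by auto
    have "ln (cmod a) \<le> cmod a - 1" and "ln (cmod a) = cmod a - 1 \<longleftrightarrow> cmod a = 1"
      using a ln_le_minus_one ln_eq_minus_one by auto
    then show ?case
      using add a N by (auto simp: norm_mult ln_mult_pos)
  qed simp
  then show "ln (cmod (prod_mset N)) + real (size N) \<le> (\<Sum>a\<in>#N. cmod a)"
    and "(\<Sum>a\<in>#N. cmod a) = ln (cmod (prod_mset N)) + real (size N) \<longleftrightarrow> (\<forall>a\<in>#N. cmod a = 1)"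
    by blast+
qed

text \<open>The tangent of \<open>ln\<close> at \<open>a\<close> lies above its graph and has slope
  \<open>1 / a \<le> 1\<close>.\<close>

lemma diff_ln_strict_mono:
  fixes a b :: real
  assumes "1 \<le> a" "a < b"
  shows "a - ln a < b - ln b"
proof -
  have "ln b - ln a < (b - a) / a"
    using assms by (intro ln_diff_less) auto
  also have "\<dots> \<le> b - a"
    using assms mult_left_mono[of 1 a "b - a"] by (simp add: field_simps)
  finally show ?thesis by linarith
qed

theorem corollary5:
  fixes R :: "real mat" and x :: "real vec" and n \<kappa> :: nat and \<rho> \<mu> :: real
  defines "C \<equiv> map_mat complex_of_real R"
  assumes "R \<in> carrier_mat n n"
    and "\<forall>i<n. \<forall>j<n. R $$ (i, j) \<ge> 0"
    and "transpose_mat R = R"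
    and "eigenvalue R \<rho>" and "\<forall>a. eigenvalue R a \<longrightarrow> a \<le> \<rho>"
    and "nullity C = \<kappa>"
    and "x \<in> carrier_vec n" and "x \<noteq> 0\<^sub>v n" and "\<forall>i<n. x $ i \<ge> 0"
    and "\<mu> = (x \<bullet> (R *\<^sub>v x)) / (x \<bullet> x)" and "\<mu> \<ge> 1"
  shows "energy C \<ge> \<mu> + real n - real \<kappa> - 1 + ln (cmod (Upsilon (n - \<kappa>) C)) - ln \<mu> \<and>
    (energy C = \<mu> + real n - real \<kappa> - 1 + ln (cmod (Upsilon (n - \<kappa>) C)) - ln \<mu> \<longleftrightarrow>
      eigenvector R x \<rho> \<and>
      (\<forall>a \<in># filter_mset (\<lambda>a. a \<noteq> 0) (eigvals C) - {#complex_of_real \<rho>#}. cmod a = 1))"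
proof -
  note R = assms(2) and sym = assms(4) and top = assms(6) and x = assms(8,9)
    and \<mu> = assms(11) and \<mu>_ge = assms(12)
  have C: "C \<in> carrier_mat n n" using R by (simp add: C_def)
  have xx: "x \<bullet> x > 0"
    using conjugate_square_greater_0_vec[OF x(1)] x(2) by simp
  have \<mu>_le: "\<mu> \<le> \<rho>"
    using symmetric_rayleigh_le[OF R sym top x(1)] xx by (simp add: \<mu> field_simps)
  have \<mu>_eq: "\<mu> = \<rho> \<longleftrightarrow> eigenvector R x \<rho>"
    unfolding symmetric_rayleigh_eq_iff[OF R sym top x, symmetric]
    using xx by (auto simp: \<mu> field_simps)
  have \<rho>_ge: "\<rho> \<ge> 1" using \<mu>_ge \<mu>_le by simp
  define N where "N = filter_mset (\<lambda>a. a \<noteq> 0) (eigvals C)"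
  \<comment> \<open>Multiset difference removes only one copy, so further copies of
    \<open>\<rho>\<close> stay in \<open>M\<close>.\<close>
  define M where "M = N - {#complex_of_real \<rho>#}"
  have "eigenvalue C (complex_of_real \<rho>)"
    unfolding C_def using of_real_hom.eigenvalue_hom[OF R assms(5)] .
  \<comment> \<open>As \<open>\<rho> \<ge> 1\<close> is nonzero, it survives the filter.\<close>
  then have "complex_of_real \<rho> \<in># N"
    using \<rho>_ge set_eigvals[OF C] by (auto simp: N_def)
  then have N: "N = add_mset (complex_of_real \<rho>) M"
    by (simp add: M_def)
  have "0 \<notin># N" by (simp add: N_def)
  then have M0: "0 \<notin># M" by (simp add: N)
  have split: "eigvals C = N + replicate_mset \<kappa> 0"
    using multiset_partition[of "eigvals C" "\<lambda>a. a \<noteq> 0"] assms(7)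
    by (simp add: N_def nullity_def filter_eq_replicate_mset)
  have size: "real (size M) = real n - real \<kappa> - 1"
    using arg_cong[OF split, of size] size_eigvals[OF C] by (simp add: N)
  have energy: "energy C = \<rho> + (\<Sum>a\<in>#M. cmod a)"
    using \<rho>_ge by (simp add: energy_def split N)
  have "Upsilon (n - \<kappa>) C = complex_of_real \<rho> * prod_mset M"
    using Upsilon_nonzero_eigvals[OF C] assms(7) by (simp add: N flip: N_def)
  moreover have "cmod (prod_mset M) > 0" using M0 by simp
  ultimately have ups: "ln (cmod (Upsilon (n - \<kappa>) C)) = ln \<rho> + ln (cmod (prod_mset M))"
    using \<rho>_ge by (simp add: norm_mult ln_mult_pos)
  show ?thesis
    unfolding N_def[symmetric] M_def[symmetric]
    \<comment> \<open>Equality makes the gap between \<open>\<mu>\<close> and \<open>\<rho>\<close>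
      and the gap of \<open>M\<close> vanish separately; these are the two conditions of the
      equality case.\<close>
    using sum_ln_cmod_gap[OF M0] diff_ln_strict_mono[OF \<mu>_ge, of \<rho>] \<mu>_le energy ups size \<mu>_eq
    by (smt (verit))
qed

end
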